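(* Let $X$ be a complex Banach space and let $T:X\to X$ be an invertible bounded linear operator with the shadowing property. Then at least one of the following holds: (i) $T$ is a uniform contraction; (ii) $T$ is a uniform expansion; (iii) $E^{c}(T)$ is dense in $X$; (iv) $T$ has a nontrivial closed invariant subspace, i.e. there is a closed linear subspace $M\subset X$ with $M\neq\{0\}$, $M\ne X$ and $T(M)\subset M$.
   Context: Let $X$ be a complex Banach space and $T:X\to X$ an invertible bounded linear operator (with bounded inverse). - $T$ has the shadowing property if for every $\epsilon>0$ there is $\delta>0$ such that for every sequence $\{x_n\}_{n\in\mathbb{Z}}\subset X$ with $\|T(x_n)-x_{n+1}\|<\delta$ for all $n\in\mathbb{Z}$, there is $x\in X$ with $\|T^n(x)-x_n\|<\epsilon$ for all $n\in\mathbb{Z}$. - $T$ is a uniform contraction if its spectral radius satisfies $r(T)<1$; $T$ is a uniform expansion if $T$ is invertible and $T^{-1}$ is a uniform contraction. - $E^{c}(T)=\{x\in X:\sup_{n\in\mathbb{Z}}\|T^n(x)\|<\infty\}$ is the set of points with bounded orbit. *)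

theory Defs
  imports "HOL-Analysis.Analysis"
begin

class complex_normed_vector = real_normed_vector +
  fixes scaleC :: "complex \<Rightarrow> 'a \<Rightarrow> 'a"  (infixr "*\<^sub>C" 75)
  assumes scaleC_add_right: "a *\<^sub>C (x + y) = a *\<^sub>C x + a *\<^sub>C y"
    and scaleC_add_left: "(a + b) *\<^sub>C x = a *\<^sub>C x + b *\<^sub>C x"
    and scaleC_scaleC: "a *\<^sub>C (b *\<^sub>C x) = (a * b) *\<^sub>C x"
    and scaleC_one: "1 *\<^sub>C x = x"
    and scaleR_scaleC: "r *\<^sub>R x = complex_of_real r *\<^sub>C x"
    and norm_scaleC: "norm (a *\<^sub>C x) = cmod a * norm x"

class complex_banach = complex_normed_vector + banach

global_interpretation complex_vector:
  vector_space "scaleC :: complex \<Rightarrow> 'a \<Rightarrow> 'a :: complex_normed_vector"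
  by unfold_locales
    (simp_all add: scaleC_add_right scaleC_add_left scaleC_scaleC scaleC_one)

instantiation complex :: complex_banach
begin

definition scaleC_complex :: "complex \<Rightarrow> complex \<Rightarrow> complex"
  where "scaleC_complex a x = a * x"

instance
  by standard (simp_all add: scaleC_complex_def algebra_simps scaleR_conv_of_real norm_mult)

end

definition bounded_clinear :: "('a::complex_normed_vector \<Rightarrow> 'b::complex_normed_vector) \<Rightarrow> bool"
  where "bounded_clinear T \<longleftrightarrow>
    bounded_linear T \<and> (\<forall>c x. T (c *\<^sub>C x) = c *\<^sub>C T x)"

definition invertible_op :: "('a::complex_normed_vector \<Rightarrow> 'a) \<Rightarrow> bool"
  where "invertible_op T \<longleftrightarrow>
    bounded_clinear T \<and> bij T \<and> bounded_clinear (inv T)"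

definition spectrum :: "('a::complex_normed_vector \<Rightarrow> 'a) \<Rightarrow> complex set"
  where "spectrum T = {z. \<not> invertible_op (\<lambda>x. T x - z *\<^sub>C x)}"

text \<open>The supremum is taken in \<^typ>\<open>ennreal\<close>, so that it needs no boundedness side condition
  and the operator on the zero space (whose spectrum is empty) has spectral radius \<open>0\<close>.\<close>

definition spectral_radius :: "('a::complex_normed_vector \<Rightarrow> 'a) \<Rightarrow> ennreal"
  where "spectral_radius T = (SUP z\<in>spectrum T. ennreal (cmod z))"

definition uniform_contraction :: "('a::complex_normed_vector \<Rightarrow> 'a) \<Rightarrow> bool"
  where "uniform_contraction T \<longleftrightarrow> bounded_clinear T \<and> spectral_radius T < 1"

definition uniform_expansion :: "('a::complex_normed_vector \<Rightarrow> 'a) \<Rightarrow> bool"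
  where "uniform_expansion T \<longleftrightarrow> invertible_op T \<and> uniform_contraction (inv T)"

text \<open>Integer iterates; meaningful for bijective \<open>T\<close> only.\<close>

definition int_iterate :: "('a \<Rightarrow> 'a) \<Rightarrow> int \<Rightarrow> 'a \<Rightarrow> 'a"
  where "int_iterate T n = (if n \<ge> 0 then T ^^ nat n else inv T ^^ nat (- n))"

definition shadowing_property :: "('a::real_normed_vector \<Rightarrow> 'a) \<Rightarrow> bool"
  where "shadowing_property T \<longleftrightarrow>
    (\<forall>\<epsilon>>0. \<exists>\<delta>>0. \<forall>x :: int \<Rightarrow> 'a. (\<forall>n. norm (T (x n) - x (n + 1)) < \<delta>) \<longrightarrow>
      (\<exists>y. \<forall>n. norm (int_iterate T n y - x n) < \<epsilon>))"

definition bounded_orbit_set :: "('a::real_normed_vector \<Rightarrow> 'a) \<Rightarrow> 'a set"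
  where "bounded_orbit_set T = {x. bdd_above (range (\<lambda>n. norm (int_iterate T n x)))}"

definition nontrivial_closed_invariant_subspace ::
    "('a::complex_normed_vector \<Rightarrow> 'a) \<Rightarrow> 'a set \<Rightarrow> bool"
  where "nontrivial_closed_invariant_subspace T M \<longleftrightarrow>
    closed M \<and> complex_vector.subspace M \<and> M \<noteq> {0} \<and> M \<noteq> UNIV \<and> T ` M \<subseteq> M"

end

theory Submission
  imports Defs
begin

text \<open>Shadowing makes the equation \<open>x (n + 1) = T (x n) + z n\<close> solvable in bounded two-sided
  sequences, with a uniform bound. If \<open>E\<^sup>c(T) = {0}\<close>, bounded solutions are unique, so a point \<open>x\<close>
  with bounded forward orbit satisfies \<open>\<parallel>T\<^sup>n x\<parallel> \<le> C \<parallel>x\<parallel>\<close> with a uniform \<open>C\<close>. Hence the set of these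
  points is a closed invariant subspace. If it is the whole space, the resonant forcing
  \<open>z n = T\<^sup>n x\<close> (for \<open>n \<ge> 0\<close>) has the solution \<open>n T\<^sup>n\<^sup>-\<^sup>1 x\<close>, whose boundedness forces some power of
  \<open>T\<close> to be a strict contraction. If it is zero, a forcing supported at one time shows that every
  backward orbit is bounded, and the same argument applies to the inverse of \<open>T\<close>.\<close>

section \<open>Complex-linear operators and closures of subspaces\<close>

lemma bounded_clinear_linear: "bounded_clinear T \<Longrightarrow> bounded_linear T"
  by (simp add: bounded_clinear_def)

lemma bounded_linear_funpow:
  fixes T :: "'a::real_normed_vector \<Rightarrow> 'a"
  assumes "bounded_linear T"
  shows "bounded_linear (T ^^ n)"
proof (induction n)
  case 0
  show ?case using bounded_linear_ident by (simp add: id_def)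
next
  case (Suc n)
  from bounded_linear_compose[OF assms this] show ?case by (simp add: o_def)
qed

lemma funpow_scaleC:
  fixes T :: "'a::complex_normed_vector \<Rightarrow> 'a"
  assumes "bounded_clinear T"
  shows "(T ^^ n) (c *\<^sub>C x) = c *\<^sub>C (T ^^ n) x"
  using assms by (induction n) (auto simp: bounded_clinear_def)

lemma bounded_linear_scaleC: "bounded_linear (\<lambda>x::'a::complex_normed_vector. c *\<^sub>C x)"
proof (rule bounded_linear_intro[where K = "cmod c"])
  show "c *\<^sub>C (r *\<^sub>R x) = r *\<^sub>R (c *\<^sub>C x)" for r and x :: 'a
    by (simp add: scaleR_scaleC scaleC_scaleC mult.commute)
qed (simp_all add: scaleC_add_right norm_scaleC mult.commute)

lemma bounded_linear_const_scaleC_minus: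
  assumes "bounded_linear (T :: 'a::complex_normed_vector \<Rightarrow> 'a)"
  shows "bounded_linear (\<lambda>x. T x - z *\<^sub>C x)"
  by (intro bounded_linear_sub assms bounded_linear_scaleC)

lemma subspace_closure_complex:
  fixes M :: "'a::complex_normed_vector set"
  assumes M: "complex_vector.subspace M"
  shows "complex_vector.subspace (closure M)"
proof (rule complex_vector.subspaceI)
  show "0 \<in> closure M"
    using complex_vector.subspace_0[OF M] closure_subset by blast
next
  fix x y assume "x \<in> closure M" "y \<in> closure M"
  then obtain f g where "\<forall>n. f n \<in> M" "f \<longlonglongrightarrow> x" "\<forall>n. g n \<in> M" "g \<longlonglongrightarrow> y"
    by (auto simp: closure_sequential)
  then show "x + y \<in> closure M"
    unfolding closure_sequential
    by (intro exI[of _ "\<lambda>n. f n + g n"])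
      (auto intro: tendsto_add complex_vector.subspace_add[OF M])
next
  fix c and x :: 'a assume "x \<in> closure M"
  then obtain f where "\<forall>n. f n \<in> M" "f \<longlonglongrightarrow> x"
    by (auto simp: closure_sequential)
  then show "c *\<^sub>C x \<in> closure M"
    unfolding closure_sequential
    by (intro exI[of _ "\<lambda>n. c *\<^sub>C f n"])
      (auto intro: bounded_linear.tendsto[OF bounded_linear_scaleC]
        complex_vector.subspace_scale[OF M])
qed

section \<open>Spectral radius of operators with a contracting power\<close>

text \<open>Neumann series: \<open>S\<close>, the sum of \<open>T^n / z^(n+1)\<close>, is dominated
  by a geometric series of ratio \<open>r / cmod z\<close>, and \<open>- S\<close> is a two-sided
  inverse.\<close>

lemma invertible_op_minus_scaleC:
  fixes T :: "'a::complex_banach \<Rightarrow> 'a"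
  assumes T: "bounded_clinear T" and r: "0 \<le> r" "r < cmod z"
    and decay: "\<And>n x. norm ((T ^^ n) x) \<le> K * r ^ n * norm x"
  shows "invertible_op (\<lambda>x. T x - z *\<^sub>C x)"
proof -
  let ?D = "\<lambda>x. T x - z *\<^sub>C x"
  let ?f = "\<lambda>n x. (1 / z ^ Suc n) *\<^sub>C (T ^^ n) x"
  define S where "S x = (\<Sum>n. ?f n x)" for x
  define q where "q = r / cmod z"
  define L where "L = K / cmod z * (1 / (1 - q))"
  have z: "z \<noteq> 0" and q: "0 \<le> q" "q < 1" using r by (auto simp: q_def divide_less_eq)
  have TL: "bounded_linear T" using T by (rule bounded_clinear_linear)
  have Tc: "T (c *\<^sub>C x) = c *\<^sub>C T x" for c x using T by (simp add: bounded_clinear_def)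
  have fle: "norm (?f n x) \<le> K / cmod z * norm x * q ^ n" for n x
  proof -
    have "norm (?f n x) = norm ((T ^^ n) x) / cmod z ^ Suc n"
      by (simp add: norm_scaleC norm_divide norm_power norm_mult)
    also have "\<dots> \<le> (K * r ^ n * norm x) / cmod z ^ Suc n"
      by (intro divide_right_mono decay) simp
    also have "\<dots> = K / cmod z * norm x * q ^ n"
      by (simp add: q_def power_divide)
    finally show ?thesis .
  qed
  have gs: "summable (\<lambda>n. K / cmod z * norm x * q ^ n)" for x
    using q by (intro summable_mult summable_geometric) auto
  have sm: "summable (\<lambda>n. ?f n x)" for x
    by (rule summable_comparison_test'[OF gs fle])
  have normS: "norm (S x) \<le> norm x * L" for x
  proof -
    have "norm (S x) \<le> (\<Sum>n. K / cmod z * norm x * q ^ n)"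
      unfolding S_def by (rule norm_suminf_le[OF fle gs])
    also have "\<dots> = norm x * L"
      using q by (subst suminf_mult) (auto simp: suminf_geometric L_def summable_geometric)
    finally show ?thesis .
  qed
  have Tn: "bounded_linear (T ^^ n)" for n by (rule bounded_linear_funpow[OF TL])
  have fc: "?f n (c *\<^sub>C x) = c *\<^sub>C ?f n x" for n c x
    by (simp only: funpow_scaleC[OF T] scaleC_scaleC mult.commute)
  have Sc: "S (c *\<^sub>C x) = c *\<^sub>C S x" for c x
    unfolding S_def fc by (rule bounded_linear.suminf[OF bounded_linear_scaleC sm, symmetric])
  have Sadd: "S (x + y) = S x + S y" for x y
    unfolding S_def suminf_add[OF sm sm]
    by (simp add: linear_add[OF bounded_linear.linear[OF Tn]] scaleC_add_right)
  have SL: "bounded_linear S"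
    by (rule bounded_linear_intro[OF Sadd _ normS]) (simp add: scaleR_scaleC Sc)
  have TS: "T (S x) = S (T x)" for x
    unfolding S_def
    by (subst bounded_linear.suminf[OF TL sm]) (simp add: Tc funpow_swap1)
  \<comment> \<open>Multiplication by \<open>z\<close> shifts the series by one index: the head
    becomes \<open>x\<close>, the tail becomes the series of \<open>T x\<close>.\<close>
  have tel: "S (T x) = z *\<^sub>C S x - x" for x
  proof -
    have "z *\<^sub>C S x = (\<Sum>n. z *\<^sub>C ?f n x)"
      unfolding S_def by (rule bounded_linear.suminf[OF bounded_linear_scaleC sm])
    also have "\<dots> = (\<Sum>n. z *\<^sub>C ?f (Suc n) x) + z *\<^sub>C ?f 0 x"
      by (subst suminf_split_head[OF bounded_linear.summable[OF bounded_linear_scaleC sm]]) simp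
    also have "z *\<^sub>C ?f 0 x = x" using z by (simp add: scaleC_scaleC scaleC_one)
    also have "(\<lambda>n. z *\<^sub>C ?f (Suc n) x) = (\<lambda>n. ?f n (T x))"
      using z by (simp add: scaleC_scaleC funpow_swap1)
    finally show ?thesis unfolding S_def by simp
  qed
  have DS: "?D (- S x) = x" for x
    using TS[of x] tel[of x] by (simp add: linear_neg[OF bounded_linear.linear[OF TL]])
  have SD: "- S (?D x) = x" for x
    using tel[of x] Sc by (simp add: linear_diff[OF bounded_linear.linear[OF SL]])
  have "bij ?D" by (rule o_bij[of "\<lambda>x. - S x"]) (use SD DS in \<open>auto simp: fun_eq_iff\<close>)
  moreover have "inv ?D = (\<lambda>x. - S x)"
    by (rule inv_unique_comp) (use SD DS in \<open>auto simp: fun_eq_iff\<close>)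
  moreover have "bounded_clinear (\<lambda>x. - S x)"
    using bounded_linear_minus[OF SL] unfolding bounded_clinear_def by (simp add: Sc)
  moreover have "bounded_clinear ?D"
    using bounded_linear_const_scaleC_minus[OF TL] unfolding bounded_clinear_def
    by (simp add: Tc scaleC_scaleC mult.commute complex_vector.scale_right_diff_distrib)
  ultimately show ?thesis by (simp add: invertible_op_def)
qed

text \<open>Writing \<open>n = j * N + i\<close>, the \<open>j\<close> blocks of length
  \<open>N\<close> halve the norm each and \<open>C\<close> controls the remainder. The resulting
  geometric decay confines the spectrum to the disc of radius \<open>r < 1\<close>.\<close>

lemma uniform_contractionI:
  fixes T :: "'a::complex_banach \<Rightarrow> 'a"
  assumes T: "bounded_clinear T"
    and bdd: "\<And>n x. norm ((T ^^ n) x) \<le> C * norm x"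
    and half: "\<And>x. norm ((T ^^ N) x) \<le> norm x / 2" and N: "N > 0"
  shows "uniform_contraction T"
proof -
  define r where "r = root N (1/2 :: real)"
  have r: "0 < r" "r < 1" and rN: "r ^ N = 1/2"
    using N by (auto simp: r_def)
  define C' where "C' = max C 0"
  have pow: "norm ((T ^^ (j * N + i)) x) \<le> (1/2) ^ j * (C' * norm x)" for i j x
  proof (induction j)
    case 0
    have "C * norm x \<le> C' * norm x" by (intro mult_right_mono) (auto simp: C'_def)
    then show ?case using bdd[of i x] by simp
  next
    case (Suc j)
    have "(T ^^ (Suc j * N + i)) x = (T ^^ N) ((T ^^ (j * N + i)) x)"
      by (simp add: funpow_add add.assoc)
    then show ?case using half[of "(T ^^ (j * N + i)) x"] Suc by simp
  qed
  have decay: "norm ((T ^^ n) x) \<le> (2 * C') * r ^ n * norm x" for n x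
  proof -
    define j i where "j = n div N" and "i = n mod N"
    have n: "n = j * N + i" and iN: "i < N" using N by (auto simp: j_def i_def)
    \<comment> \<open>Since \<open>i < N\<close>, replacing \<open>(1/2)^j = r^(j * N)\<close> by
      \<open>r^n\<close> costs at most a factor 2, the one in \<open>decay\<close>.\<close>
    have "1/2 \<le> r ^ i"
      using power_decreasing[of i N r] iN r rN by simp
    then have "(1/2) ^ j * (1/2) \<le> (1/2) ^ j * r ^ i"
      by (intro mult_left_mono) auto
    also have "\<dots> = r ^ n"
      by (simp add: n power_add mult.commute[of j N] power_mult rN)
    finally have "(1/2) ^ j \<le> 2 * r ^ n" by simp
    then have "(1/2) ^ j * (C' * norm x) \<le> 2 * r ^ n * (C' * norm x)"
      by (intro mult_right_mono) (auto simp: C'_def)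
    with pow[of j i x] show ?thesis by (simp add: n mult_ac)
  qed
  have "cmod z \<le> r" if "z \<in> spectrum T" for z
    using invertible_op_minus_scaleC[OF T _ _ decay, of z] that r
    by (force simp: spectrum_def)
  then have "spectral_radius T \<le> ennreal r"
    unfolding spectral_radius_def by (intro SUP_least ennreal_leI)
  also have "\<dots> < 1" using r by (simp add: ennreal_less_one_iff)
  finally show ?thesis using T by (simp add: uniform_contraction_def)
qed

section \<open>Two-sided orbits\<close>

lemma int_iterate_add_1:
  assumes "bij T"
  shows "int_iterate T (n + 1) x = T (int_iterate T n x)"
proof (cases "n \<ge> 0")
  case True
  then show ?thesis by (simp add: int_iterate_def nat_add_distrib)
next
  case False
  then have "nat (- n) = Suc (nat (- (n + 1)))" by simp
  then have "T (int_iterate T n x) = (inv T ^^ nat (- (n + 1))) x"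
    using False surj_f_inv_f[OF bij_is_surj[OF assms]] by (simp add: int_iterate_def)
  also have "\<dots> = int_iterate T (n + 1) x"
    using False by (cases "n = - 1") (auto simp: int_iterate_def)
  finally show ?thesis by simp
qed

text \<open>The recursion is assumed on one side of \<open>m\<close> only, here and in the backward
  version, because the forcings met later vanish only on a half-line.\<close>

lemma orbit_forward:
  assumes "\<And>n::int. n \<ge> m \<Longrightarrow> x (n + 1) = T (x n)"
  shows "x (m + int k) = (T ^^ k) (x m)"
proof (induction k)
  case (Suc k)
  have "x (m + int (Suc k)) = x ((m + int k) + 1)" by (simp add: algebra_simps)
  also have "\<dots> = T (x (m + int k))" by (rule assms) simp
  finally show ?case using Suc by simp
qed simp

lemma orbit_backward:
  assumes "bij T" and "\<And>n::int. n < m \<Longrightarrow> x (n + 1) = T (x n)"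
  shows "x (m - int k) = (inv T ^^ k) (x m)"
proof (induction k)
  case (Suc k)
  have "x (m - int k) = T (x (m - int k - 1))"
    using assms(2)[of "m - int k - 1"] by simp
  then have "inv T (x (m - int k)) = x (m - int (Suc k))"
    using assms(1) by (simp add: bij_is_inj algebra_simps)
  then show ?case using Suc by simp
qed simp

lemma orbit_int_iterate:
  assumes "bij T" and "\<And>n::int. x (n + 1) = T (x n)"
  shows "x n = int_iterate T n (x 0)"
proof (cases "n \<ge> 0")
  case True
  then show ?thesis using orbit_forward[of 0 x T "nat n"] assms by (simp add: int_iterate_def)
next
  case False
  then show ?thesis
    using orbit_backward[of T 0 x "nat (- n)"] assms by (simp add: int_iterate_def)
qed

section \<open>The inhomogeneous equation and shadowing\<close>

lemma inhomogeneous_solution_exists: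
  fixes T :: "'a::ab_group_add \<Rightarrow> 'a"
  assumes "bij T"
  shows "\<exists>p. \<forall>n::int. p (n + 1) = T (p n) + z n"
proof -
  define f where "f = rec_nat 0 (\<lambda>k a. T a + z (int k))"
  \<comment> \<open>\<open>g k\<close> is the value at time \<open>-k\<close>, found by solving the
    equation at time \<open>-k-1\<close> for its earlier term. The solution so built may be
    unbounded.\<close>
  define g where "g = rec_nat 0 (\<lambda>k a. inv T (a - z (- int k - 1)))"
  define p where "p n = (if n \<ge> 0 then f (nat n) else g (nat (- n)))" for n :: int
  have "p (n + 1) = T (p n) + z n" for n
  proof (cases "n \<ge> 0")
    case True
    then show ?thesis by (simp add: p_def f_def nat_add_distrib)
  next
    case False
    define k where "k = nat (- (n + 1))"
    have k: "nat (- n) = Suc k" "n = - int k - 1" using False by (auto simp: k_def)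
    have "T (p n) = g k - z n"
      using False surj_f_inv_f[OF bij_is_surj[OF assms]] by (simp add: p_def k(1) g_def flip: k(2))
    moreover have "p (n + 1) = g k"
      using False by (cases "n = - 1") (auto simp: p_def f_def g_def k_def)
    ultimately show ?thesis by simp
  qed
  then show ?thesis by blast
qed

text \<open>Any solution \<open>p\<close> for the forcing scaled by \<open>\<delta> / 2\<close> is a
  pseudo-orbit with error below \<open>\<delta>\<close>. Subtracting an orbit that shadows it within
  1 leaves a bounded solution; undoing the scaling gives the constant
  \<open>2 / \<delta>\<close>.\<close>

lemma shadowing_bounded_solution:
  fixes T :: "'a::real_normed_vector \<Rightarrow> 'a"
  assumes T: "bounded_linear T" "bij T" and sh: "shadowing_property T"
  shows "\<exists>C. \<forall>z::int \<Rightarrow> 'a. (\<forall>n. norm (z n) \<le> 1) \<longrightarrow>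
    (\<exists>x. \<forall>n. x (n + 1) = T (x n) + z n \<and> norm (x n) \<le> C)"
proof -
  obtain \<delta> where \<delta>: "\<delta> > 0" and shd: "\<And>x :: int \<Rightarrow> 'a.
      (\<forall>n. norm (T (x n) - x (n + 1)) < \<delta>) \<Longrightarrow> \<exists>y. \<forall>n. norm (int_iterate T n y - x n) < 1"
    using sh unfolding shadowing_property_def by (meson zero_less_one)
  interpret T: bounded_linear T by fact
  have "\<exists>x. \<forall>n. x (n + 1) = T (x n) + z n \<and> norm (x n) \<le> 2 / \<delta>"
    if z: "\<And>n. norm (z n) \<le> 1" for z :: "int \<Rightarrow> 'a"
  proof -
    obtain p where p: "\<And>n::int. p (n + 1) = T (p n) + (\<delta> / 2) *\<^sub>R z n"
      using inhomogeneous_solution_exists[OF T(2), of "\<lambda>n. (\<delta> / 2) *\<^sub>R z n"] by blast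
    have "norm (T (p n) - p (n + 1)) < \<delta>" for n
    proof -
      have "norm (T (p n) - p (n + 1)) = \<delta> / 2 * norm (z n)"
        using \<delta> by (simp add: p)
      also have "\<dots> \<le> \<delta> / 2 * 1" using \<delta> z by (intro mult_left_mono) auto
      also have "\<dots> < \<delta>" using \<delta> by simp
      finally show ?thesis .
    qed
    then obtain y where y: "\<And>n. norm (int_iterate T n y - p n) < 1" using shd by blast
    define x where "x n = (2 / \<delta>) *\<^sub>R (p n - int_iterate T n y)" for n
    have "x (n + 1) = T (x n) + z n" for n
      unfolding x_def p int_iterate_add_1[OF T(2)] using \<delta>
      by (simp add: T.scaleR T.diff algebra_simps)
    moreover have "norm (x n) \<le> 2 / \<delta>" for n
    proof -
      have "norm (x n) = 2 / \<delta> * norm (int_iterate T n y - p n)"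
        using \<delta> by (simp add: x_def norm_minus_commute)
      also have "\<dots> \<le> 2 / \<delta> * 1"
        using \<delta> y[of n] by (intro mult_left_mono) auto
      finally show ?thesis by simp
    qed
    ultimately show ?thesis by blast
  qed
  then show ?thesis by blast
qed

section \<open>The points with bounded two-sided orbit\<close>

lemma bounded_orbit_set_subspace:
  assumes "invertible_op T"
  shows "complex_vector.subspace (bounded_orbit_set T)"
proof -
  have T: "bounded_clinear T" "bounded_clinear (inv T)"
    using assms by (auto simp: invertible_op_def)
  have L: "linear (int_iterate T n)" for n
    using T by (simp add: int_iterate_def bounded_linear.linear bounded_linear_funpow
        bounded_clinear_linear)
  have C: "int_iterate T n (c *\<^sub>C x) = c *\<^sub>C int_iterate T n x" for n c x
    using T by (simp add: int_iterate_def funpow_scaleC)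
  show ?thesis
  proof (rule complex_vector.subspaceI)
    show "0 \<in> bounded_orbit_set T"
      by (auto simp: bounded_orbit_set_def linear_0[OF L])
  next
    fix x y assume "x \<in> bounded_orbit_set T" "y \<in> bounded_orbit_set T"
    then obtain a b where "\<And>n. norm (int_iterate T n x) \<le> a" "\<And>n. norm (int_iterate T n y) \<le> b"
      by (auto simp: bounded_orbit_set_def bdd_above_def)
    then have "norm (int_iterate T n (x + y)) \<le> a + b" for n
      by (simp add: linear_add[OF L] norm_triangle_mono)
    then show "x + y \<in> bounded_orbit_set T"
      by (auto simp: bounded_orbit_set_def bdd_above_def)
  next
    fix c x assume "x \<in> bounded_orbit_set T"
    then obtain a where "\<And>n. norm (int_iterate T n x) \<le> a"
      by (auto simp: bounded_orbit_set_def bdd_above_def)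
    then have "norm (int_iterate T n (c *\<^sub>C x)) \<le> cmod c * a" for n
      by (simp add: C norm_scaleC mult_left_mono)
    then show "c *\<^sub>C x \<in> bounded_orbit_set T"
      by (auto simp: bounded_orbit_set_def bdd_above_def)
  qed
qed

lemma bounded_orbit_set_invariant:
  assumes "bij T"
  shows "T ` bounded_orbit_set T \<subseteq> bounded_orbit_set T"
proof -
  \<comment> \<open>The orbit of \<open>T x\<close> is the orbit of \<open>x\<close> shifted by one,
    so no new norms occur along it.\<close>
  have "int_iterate T n (T x) = int_iterate T (n + 1) x" for n x
  proof -
    have "int_iterate T (n + 1) x = int_iterate T n (int_iterate T (0 + 1) x)"
      by (rule orbit_int_iterate[OF assms]) (rule int_iterate_add_1[OF assms])
    then show ?thesis by (simp add: int_iterate_def)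
  qed
  then have "range (\<lambda>n. norm (int_iterate T n (T x))) \<subseteq> range (\<lambda>n. norm (int_iterate T n x))" for x
    by auto
  then have "bdd_above (range (\<lambda>n. norm (int_iterate T n (T x))))"
    if "bdd_above (range (\<lambda>n. norm (int_iterate T n x)))" for x
    using bdd_above_mono[OF that] by simp
  then show ?thesis by (auto simp: bounded_orbit_set_def)
qed

section \<open>The stable subspace\<close>

text \<open>Only boundedness is asked; decay is derived when this set is the whole space.\<close>

definition stable_set :: "('a::real_normed_vector \<Rightarrow> 'a) \<Rightarrow> 'a set"
  where "stable_set T = {x. \<exists>B. \<forall>n. norm ((T ^^ n) x) \<le> B}"

text \<open>Bounded solvability replaces shadowing, and triviality of bounded orbits expresses
  expansivity. Phrased with sequences, both pass to shifts and to \<open>inv T\<close> by reindexing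
  time, so the contraction argument serves twice.\<close>

locale expansive_solvable =
  fixes T :: "'a::complex_banach \<Rightarrow> 'a" and C :: real
  assumes invertible: "invertible_op T"
    and bounded_solution: "\<And>z :: int \<Rightarrow> 'a. (\<And>n. norm (z n) \<le> 1) \<Longrightarrow>
      \<exists>x. \<forall>n. x (n + 1) = T (x n) + z n \<and> norm (x n) \<le> C"
    and bounded_orbit_zero: "\<And>(x :: int \<Rightarrow> 'a) B. (\<And>n. x (n + 1) = T (x n)) \<Longrightarrow>
      (\<And>n. norm (x n) \<le> B) \<Longrightarrow> x 0 = 0"
begin

lemma clinear: "bounded_clinear T" and bij: "bij T" and clinear_inv: "bounded_clinear (inv T)"
  using invertible by (auto simp: invertible_op_def)

sublocale T: bounded_linear T by (rule bounded_clinear_linear[OF clinear])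

sublocale Tn: bounded_linear "T ^^ n" for n by (rule bounded_linear_funpow[OF T.bounded_linear])

lemma bounded_orbit_zero_everywhere:
  assumes x: "\<And>n::int. x (n + 1) = T (x n)" and B: "\<And>n. norm (x n) \<le> B"
  shows "x m = 0"
proof -
  have "x (n + 1 + m) = T (x (n + m))" for n
    using x[of "n + m"] by (simp add: algebra_simps)
  then show ?thesis using bounded_orbit_zero[of "\<lambda>n. x (n + m)" B] B by simp
qed

text \<open>Bounded solutions are unique, since two of them differ by a bounded orbit. Hence
  \<open>w\<close> is the rescaled solution supplied by \<open>bounded_solution\<close>, and the a
  priori bound \<open>B\<close> disappears from the estimate.\<close>

lemma solution_norm_le:
  assumes w: "\<And>n::int. w (n + 1) = T (w n) + z n" and B: "\<And>n. norm (w n) \<le> B"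
    and z: "\<And>n. norm (z n) \<le> K" and K: "K > 0"
  shows "norm (w m) \<le> C * K"
proof -
  have "norm (inverse K *\<^sub>R z n) \<le> 1" for n
    using z[of n] K by (simp add: field_simps)
  from bounded_solution[of "\<lambda>n. inverse K *\<^sub>R z n", OF this] obtain x
    where x: "\<And>n. x (n + 1) = T (x n) + inverse K *\<^sub>R z n" "\<And>n. norm (x n) \<le> C" by blast
  define v where "v n = w n - K *\<^sub>R x n" for n
  have "v (n + 1) = T (v n)" for n
    unfolding v_def w x(1) using K by (simp add: T.diff T.scaleR algebra_simps)
  moreover have "norm (v n) \<le> B + K * C" for n
  proof -
    have "norm (v n) \<le> norm (w n) + norm (K *\<^sub>R x n)" unfolding v_def by (rule norm_triangle_ineq4)
    also have "\<dots> \<le> B + K * C" using B x(2) K by (intro add_mono) (auto intro: mult_left_mono)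
    finally show ?thesis .
  qed
  ultimately have "v m = 0" by (rule bounded_orbit_zero_everywhere)
  then have "w m = K *\<^sub>R x m" by (simp add: v_def)
  then show ?thesis using x(2)[of m] K by (simp add: mult.commute)
qed

text \<open>The truncated forward orbit is the bounded solution for a forcing supported at time \<open>-1\<close>.\<close>

lemma stable_norm_le:
  assumes "x \<in> stable_set T"
  shows "norm ((T ^^ k) x) \<le> C * norm x"
proof (cases "x = 0")
  case True
  then show ?thesis by (simp add: Tn.zero)
next
  case False
  obtain B where B: "\<And>n. norm ((T ^^ n) x) \<le> B" using assms by (auto simp: stable_set_def)
  define w where "w n = (if n \<ge> 0 then (T ^^ nat n) x else 0)" for n :: int
  define z where "z n = (if n = - 1 then x else 0)" for n :: int
  have "B \<ge> 0" using B[of 0] norm_ge_zero[of x] by (simp del: norm_ge_zero)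
  have "w (n + 1) = T (w n) + z n" for n
    by (auto simp: w_def z_def nat_add_distrib T.zero)
  moreover have "norm (w n) \<le> B" for n using B \<open>B \<ge> 0\<close> by (simp add: w_def)
  moreover have "norm (z n) \<le> norm x" for n by (simp add: z_def)
  ultimately have "norm (w (int k)) \<le> C * norm x"
    by (rule solution_norm_le) (use False in simp)
  then show ?thesis by (simp add: w_def)
qed

text \<open>With an arbitrary bound the set is a union of closed sets; the uniform constant makes it
  an intersection, hence closed.\<close>

lemma stable_set_eq: "stable_set T = (\<Inter>k. {x. norm ((T ^^ k) x) \<le> C * norm x})"
proof
  show "(\<Inter>k. {x. norm ((T ^^ k) x) \<le> C * norm x}) \<subseteq> stable_set T"
    unfolding stable_set_def by blast
qed (auto intro: stable_norm_le)

lemma closed_stable_set: "closed (stable_set T)"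
  unfolding stable_set_eq
  by (intro closed_INT ballI closed_Collect_le continuous_intros Tn.continuous_on)

lemma subspace_stable_set: "complex_vector.subspace (stable_set T)"
proof (rule complex_vector.subspaceI)
  show "0 \<in> stable_set T" by (auto simp: stable_set_def Tn.zero)
next
  fix x y assume "x \<in> stable_set T" "y \<in> stable_set T"
  then have "norm ((T ^^ n) (x + y)) \<le> C * norm x + C * norm y" for n
    by (simp add: Tn.add norm_triangle_mono stable_norm_le)
  then show "x + y \<in> stable_set T" by (auto simp: stable_set_def)
next
  fix c x assume "x \<in> stable_set T"
  then have "norm ((T ^^ n) (c *\<^sub>C x)) \<le> cmod c * (C * norm x)" for n
    by (simp add: funpow_scaleC[OF clinear] norm_scaleC stable_norm_le mult_left_mono)
  then show "c *\<^sub>C x \<in> stable_set T" by (auto simp: stable_set_def)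
qed

lemma stable_set_invariant: "T ` stable_set T \<subseteq> stable_set T"
proof (clarsimp simp: stable_set_def)
  fix x B assume "\<forall>n. norm ((T ^^ n) x) \<le> B"
  then have "norm ((T ^^ n) (T x)) \<le> B" for n
    by (metis funpow_swap1 funpow.simps(2) o_apply)
  then show "\<exists>B. \<forall>n. norm ((T ^^ n) (T x)) \<le> B" by blast
qed

text \<open>The response to the resonant forcing grows linearly yet stays below \<open>C\<close>. So
  \<open>(T ^^ n) x\<close> is bounded by a constant times \<open>norm x / (n + 1)\<close>, and one
  exponent halves all norms.\<close>

lemma stable_imp_uniform_contraction:
  assumes st: "stable_set T = UNIV"
  shows "uniform_contraction T"
proof -
  have bd: "norm ((T ^^ n) x) \<le> C * norm x" for n x
    using stable_norm_le[of x n] st by simp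
  \<comment> \<open>A constant that is at least 1 makes \<open>K\<close> positive and can be
    cancelled at the end.\<close>
  define C' where "C' = max C 1"
  have C': "C' \<ge> 1" "C \<le> C'" by (auto simp: C'_def)
  have bd': "norm ((T ^^ n) x) \<le> C' * norm x" for n x
    using bd[of n x] mult_right_mono[OF C'(2), of "norm x"] by simp
  have lin: "real (Suc n) * norm ((T ^^ n) x) \<le> C' * C' * norm x" for n x
  proof (cases "x = 0")
    case True
    then show ?thesis by (simp add: Tn.zero)
  next
    case False
    define K where "K = C' * norm x"
    have K: "K > 0" using False C' by (simp add: K_def)
    define z where "z n = (if n \<ge> 0 then (T ^^ nat n) (inverse K *\<^sub>R x) else 0)" for n :: int
    have "norm (z n) \<le> 1" for n
    proof -
      have "norm ((T ^^ k) (inverse K *\<^sub>R x)) \<le> 1" for k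
        using bd'[of k x] K by (simp add: Tn.scaleR K_def[symmetric] field_simps)
      then show ?thesis by (simp add: z_def)
    qed
    from bounded_solution[of z, OF this] obtain w
      where w: "\<And>n. w (n + 1) = T (w n) + z n" "\<And>n. norm (w n) \<le> C" by blast
    \<comment> \<open>The forcing vanishes at negative times, so the past of \<open>w\<close> is the
      backward orbit of \<open>w 0\<close>. Its forward orbit is bounded by \<open>bd\<close>, so
      the whole orbit is bounded and therefore zero.\<close>
    have w0: "w 0 = 0"
    proof -
      define v where "v n = int_iterate T n (w 0)" for n
      have past: "w (- int k) = (inv T ^^ k) (w 0)" for k
        using orbit_backward[OF bij, of 0 w k] w(1) by (simp add: z_def)
      have "norm (v n) \<le> max C (C * norm (w 0))" for n
      proof (cases "n \<ge> 0")
        case True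
        then show ?thesis using bd[of "nat n" "w 0"] by (simp add: v_def int_iterate_def)
      next
        case False
        then have "v n = w n" using past[of "nat (- n)"] by (simp add: v_def int_iterate_def)
        then show ?thesis using w(2)[of n] by simp
      qed
      moreover have "v (n + 1) = T (v n)" for n by (simp add: v_def int_iterate_add_1[OF bij])
      ultimately have "v 0 = 0" by (intro bounded_orbit_zero)
      then show ?thesis by (simp add: v_def int_iterate_def)
    qed
    \<comment> \<open>The forcing at time 0 first shows at time 1; each later step transports the
      earlier contributions and adds an equal one.\<close>
    have wn: "w (int k + 1) = real (Suc k) *\<^sub>R (T ^^ k) (inverse K *\<^sub>R x)" for k
    proof (induction k)
      case 0
      show ?case using w(1)[of 0] w0 by (simp add: T.zero z_def)
    next
      case (Suc k)
      have "w (int (Suc k) + 1) = T (w (int k + 1)) + z (int (Suc k))"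
        using w(1)[of "int (Suc k)"] by (simp add: add.commute)
      also have "\<dots> = real (Suc k) *\<^sub>R (T ^^ Suc k) (inverse K *\<^sub>R x) + (T ^^ Suc k) (inverse K *\<^sub>R x)"
        unfolding Suc by (simp add: z_def T.scaleR nat_add_distrib)
      also have "\<dots> = real (Suc (Suc k)) *\<^sub>R (T ^^ Suc k) (inverse K *\<^sub>R x)"
        by (simp add: scaleR_left_distrib scaleR_2)
      finally show ?case .
    qed
    have "real (Suc n) * (inverse K * norm ((T ^^ n) x)) \<le> C"
      using w(2)[of "int n + 1"] K unfolding wn by (simp add: Tn.scaleR)
    then have "real (Suc n) * norm ((T ^^ n) x) \<le> C * K"
      using K by (simp add: field_simps)
    also have "\<dots> \<le> C' * K" using C' K by (intro mult_right_mono) auto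
    finally show ?thesis by (simp add: K_def mult.assoc)
  qed
  \<comment> \<open>At this size of \<open>N\<close>, dividing \<open>lin\<close> by
    \<open>N + 1\<close> leaves a factor of at most 1/2.\<close>
  obtain N where N: "real N \<ge> 2 * (C' * C')" using real_arch_simple by blast
  have "norm ((T ^^ N) x) \<le> norm x / 2" for x
  proof -
    have "2 * (C' * C') * norm ((T ^^ N) x) \<le> real (Suc N) * norm ((T ^^ N) x)"
      using N by (intro mult_right_mono) auto
    also have "\<dots> \<le> C' * C' * norm x" by (rule lin)
    finally have "(C' * C') * (2 * norm ((T ^^ N) x)) \<le> (C' * C') * norm x" by (simp add: mult_ac)
    moreover have "C' * C' > 0" using C' by simp
    ultimately show ?thesis by (simp add: mult_le_cancel_left_pos)
  qed
  moreover have "N > 0"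
  proof -
    have "2 * (C' * C') > 0" using C' by simp
    with N show ?thesis by linarith
  qed
  ultimately show ?thesis by (intro uniform_contractionI[OF clinear bd])
qed

text \<open>Let the forcing be a single kick \<open>u\<close> at time \<open>-1\<close>. From time 0
  on the bounded solution is a free orbit, so \<open>w 0\<close> is stable and hence zero. Thus
  \<open>w (-1)\<close> is \<open>- inv T u\<close>, and the past of \<open>w\<close> bounds the
  backward orbit of \<open>u\<close>.\<close>

lemma stable_set_inv:
  assumes st: "stable_set T = {0}"
  shows "stable_set (inv T) = UNIV"
proof -
  have "x \<in> stable_set (inv T)" if ne: "x \<noteq> 0" for x
  proof -
    define u where "u = inverse (norm x) *\<^sub>R x"
    define z where "z n = (if n = - 1 then u else 0)" for n :: int
    have "norm (z n) \<le> 1" for n using ne by (simp add: z_def u_def)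
    from bounded_solution[of z, OF this] obtain w
      where w: "\<And>n. w (n + 1) = T (w n) + z n" "\<And>n. norm (w n) \<le> C"
      by blast
    have "w (0 + int k) = (T ^^ k) (w 0)" for k
      by (rule orbit_forward) (simp add: w(1) z_def)
    then have "norm ((T ^^ k) (w 0)) \<le> C" for k using w(2)[of "int k"] by simp
    then have "w 0 \<in> stable_set T" by (auto simp: stable_set_def)
    then have "w 0 = 0" using st by simp
    then have "T (w (- 1)) + u = 0" using w(1)[of "- 1"] by (simp add: z_def)
    then have "u = T (- w (- 1))" by (simp add: T.neg eq_neg_iff_add_eq_0 add.commute)
    then have iu: "inv T u = - w (- 1)" using bij by (simp add: bij_is_inj)
    interpret I: bounded_linear "inv T ^^ n" for n
      by (rule bounded_linear_funpow[OF bounded_clinear_linear[OF clinear_inv]])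
    have "w (- 1 - int k) = (inv T ^^ k) (w (- 1))" for k
      by (rule orbit_backward[OF bij]) (simp add: w(1) z_def)
    then have "norm ((inv T ^^ k) (inv T u)) \<le> C" for k
      using w(2)[of "- 1 - int k"] by (simp add: iu I.neg)
    \<comment> \<open>The past of \<open>w\<close> covers only \<open>k >= 1\<close>;
      \<open>norm u\<close> accounts for \<open>k = 0\<close>.\<close>
    then have "norm ((inv T ^^ k) u) \<le> max C (norm u)" for k
      by (cases k) (auto simp: funpow_swap1 le_max_iff_disj)
    moreover have "(inv T ^^ k) x = norm x *\<^sub>R (inv T ^^ k) u" for k
      using ne by (simp add: u_def I.scaleR)
    ultimately have "norm ((inv T ^^ k) x) \<le> norm x * max C (norm u)" for k
      by (simp add: mult_left_mono del: max.bounded_iff)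
    then show ?thesis by (auto simp: stable_set_def)
  qed
  moreover have "0 \<in> stable_set (inv T)"
    using linear_0[OF bounded_linear.linear[OF bounded_linear_funpow[OF
        bounded_clinear_linear[OF clinear_inv]]]]
    by (auto simp: stable_set_def)
  ultimately have "x \<in> stable_set (inv T)" for x by (cases "x = 0") simp_all
  then show ?thesis by auto
qed

text \<open>Time reversal: \<open>n \<mapsto> x (- n)\<close> solves the equation of \<open>inv T\<close> with forcing \<open>z\<close> iff \<open>x\<close> solves that
  of \<open>T\<close> with forcing \<open>n \<mapsto> - T (z (- n - 1))\<close>.\<close>

lemma expansive_solvable_inv: "\<exists>C'. expansive_solvable (inv T) C'"
proof -
  obtain K where K: "K > 0" "\<And>x. norm (T x) \<le> norm x * K" using T.pos_bounded by blast
  have inv_T: "inv T (T x) = x" and T_inv: "T (inv T x) = x" for x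
    using bij by (simp_all add: bij_is_inj bij_is_surj surj_f_inv_f)
  \<comment> \<open>The reversed forcing passes through \<open>T\<close>, whose norm is at most
    \<open>K\<close>. It is divided by \<open>K\<close> before solving, and the solution is
    multiplied by \<open>K\<close> afterwards.\<close>
  have "expansive_solvable (inv T) (K * C)"
  proof
    show "invertible_op (inv T)"
      using clinear clinear_inv bij by (simp add: invertible_op_def inv_inv_eq bij_imp_bij_inv)
  next
    fix z :: "int \<Rightarrow> 'a" assume z: "\<And>n. norm (z n) \<le> 1"
    have "norm (- inverse K *\<^sub>R T (z (- n - 1))) \<le> 1" for n
    proof -
      have "norm (T (z (- n - 1))) \<le> 1 * K"
        using K z by (meson order_trans mult_right_mono less_imp_le)
      then show ?thesis using K by (simp add: field_simps)
    qed
    from bounded_solution[of "\<lambda>n. - inverse K *\<^sub>R T (z (- n - 1))", OF this] obtain x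
      where x: "\<And>n. x (n + 1) = T (x n) - inverse K *\<^sub>R T (z (- n - 1))" "\<And>n. norm (x n) \<le> C"
      by auto
    have "K *\<^sub>R x (- (n + 1)) = inv T (K *\<^sub>R x (- n)) + z n" for n
    proof -
      have "x (- n) = T (x (- n - 1)) - inverse K *\<^sub>R T (z n)"
        using x(1)[of "- n - 1"] by simp
      then have "K *\<^sub>R x (- n) = T (K *\<^sub>R x (- n - 1) - z n)"
        using K by (simp add: T.scaleR T.diff scaleR_diff_right)
      then show ?thesis by (simp add: inv_T)
    qed
    moreover have "norm (K *\<^sub>R x (- n)) \<le> K * C" for n
      using K x(2) by (simp add: mult_left_mono)
    ultimately show "\<exists>x. \<forall>n. x (n + 1) = inv T (x n) + z n \<and> norm (x n) \<le> K * C"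
      by (intro exI[of _ "\<lambda>n. K *\<^sub>R x (- n)"]) blast
  next
    fix x :: "int \<Rightarrow> 'a" and B
    assume x: "\<And>n. x (n + 1) = inv T (x n)" and B: "\<And>n. norm (x n) \<le> B"
    have "x (- (n + 1)) = T (x (- n))" for n
      using x[of "- n - 1"] by (simp add: T_inv)
    then show "x 0 = 0" using bounded_orbit_zero[of "\<lambda>n. x (- n)" B] B by simp
  qed
  then show ?thesis by blast
qed

end

section \<open>Excluding all four alternatives at once\<close>

theorem theorem2p4:
  fixes T :: "'a::complex_banach \<Rightarrow> 'a"
  assumes "invertible_op T"
    and "shadowing_property T"
  shows "uniform_contraction T
    \<or> uniform_expansion T
    \<or> closure (bounded_orbit_set T) = UNIV
    \<or> (\<exists>M. nontrivial_closed_invariant_subspace T M)"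
proof (rule ccontr)
  assume contr: "\<not> ?thesis"
  have T: "bounded_linear T" "bij T"
    using assms(1) by (auto simp: invertible_op_def bounded_clinear_def)
  have triv: "M = {0} \<or> M = UNIV"
    if "closed M" "complex_vector.subspace M" "T ` M \<subseteq> M" for M
    using that contr by (auto simp: nontrivial_closed_invariant_subspace_def)
  have "T ` closure (bounded_orbit_set T) \<subseteq> closure (bounded_orbit_set T)"
    using bounded_orbit_set_invariant[OF T(2)] T(1)
    by (intro image_closure_subset) (auto intro: linear_continuous_on closure_subset[THEN subsetD])
  \<comment> \<open>The closure is a closed invariant subspace that is not dense, so it must be
    trivial; this is the expansivity needed for the locale.\<close>
  then have "closure (bounded_orbit_set T) = {0}"
    using triv[of "closure (bounded_orbit_set T)"] contr
      subspace_closure_complex[OF bounded_orbit_set_subspace[OF assms(1)]] by auto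
  then have zero: "bounded_orbit_set T \<subseteq> {0}" using closure_subset by blast
  obtain C where C: "\<And>z::int \<Rightarrow> 'a. (\<And>n. norm (z n) \<le> 1) \<Longrightarrow>
      \<exists>x. \<forall>n. x (n + 1) = T (x n) + z n \<and> norm (x n) \<le> C"
    using shadowing_bounded_solution[OF T assms(2)] by blast
  interpret expansive_solvable T C
  proof
    fix x :: "int \<Rightarrow> 'a" and B
    assume x: "\<And>n. x (n + 1) = T (x n)" and B: "\<And>n. norm (x n) \<le> B"
    have "norm (int_iterate T n (x 0)) \<le> B" for n
      using B[of n] orbit_int_iterate[OF T(2), of x n] x by simp
    then have "x 0 \<in> bounded_orbit_set T"
      by (auto simp: bounded_orbit_set_def bdd_above_def)
    then show "x 0 = 0" using zero by blast
  qed (use assms C in auto)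
  \<comment> \<open>The stable set is also a closed invariant subspace. Being the whole space would
    make \<open>T\<close> a contraction; being zero makes the stable set of \<open>inv T\<close>
    everything, so \<open>T\<close> is an expansion.\<close>
  have "stable_set T \<noteq> UNIV" using stable_imp_uniform_contraction contr by blast
  then have "stable_set T = {0}"
    using triv closed_stable_set subspace_stable_set stable_set_invariant by blast
  then have "stable_set (inv T) = UNIV" by (rule stable_set_inv)
  moreover obtain C' where "expansive_solvable (inv T) C'" using expansive_solvable_inv by blast
  ultimately have "uniform_contraction (inv T)"
    by (simp add: expansive_solvable.stable_imp_uniform_contraction)
  then show False using contr assms(1) by (simp add: uniform_expansion_def)
qed

end
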